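(* Let $k\ge2$ and let $f\colon\mathbb{N}_0\to\{0,1\}$ be a sparse $k$-automatic sequence. Then either $f$ is very sparse (in base $k$), or there exists an IPS-set $E$ such that $f(n)=1$ for all $n\in E$.
   Context: $\mathbb{N}=\{1,2,\dots\}$, $\mathbb{N}_0=\{0,1,2,\dots\}$. The upper Banach density of $E\subset\mathbb{N}_0$ is $\limsup_{N\to\infty}\max_M|E\cap[M,M+N)|/N$; a sequence $f\colon\mathbb{N}_0\to\{0,1\}$ is sparse if it is the characteristic function of a set of upper Banach density $0$. For $k\ge2$ let $\Sigma_k=\{0,\dots,k-1\}$, let $\Sigma_k^*$ be the set of finite words over $\Sigma_k$ (including the empty word); for $w\in\Sigma_k^*$ let $[w]_k$ be the integer whose base-$k$ expansion is $w$ (leading zeros allowed, most significant digit first), and for $n\ge0$ let $(n)_k$ be the base-$k$ representation of $n$ without leading zeros ($(0)_k$ is the empty word). A $k$-automaton $(S,s_\bullet,\delta,\Omega,\tau)$ consists of a finite set of states $S$, an initial state $s_\bullet\in S$, a transition map $\delta\colon S\times\Sigma_k\to S$ (extended to $\tilde\delta\colon S\times\Sigma_k^*\to S$ by reading a word letter by letter from left to right), an output set $\Omega$ and an output map $\tau\colon S\to\Omega$. A sequence $(a_n)_{n\ge0}$ with values in a finite set $\Omega$ is $k$-automatic if there is a $k$-automaton with $a_n=\tau(\tilde\delta(s_\bullet,(n)_k))$ for all $n$. A basic very sparse set of rank $r\ge0$, base $k$, is a set of the form $\{[w_0u_1^{l_1}w_1u_2^{l_2}\cdots u_r^{l_r}w_r]_k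 : l_1,\dots,l_r\in\mathbb{N}_0\}$ with $u_1,\dots,u_r,w_0,\dots,w_r\in\Sigma_k^*$. A very sparse set (of rank $r$, base $k$) is a finite union of basic very sparse sets (of rank $r$, base $k$). A sequence $f\colon\mathbb{N}_0\to\{0,1\}$ is very sparse if $\{n: f(n)=1\}$ is very sparse. For a sequence $(n_i)_{i\in\mathbb{N}}\subset\mathbb{N}$ and shifts $(N_t)_{t\ge1}\subset\mathbb{N}_0$ put $\mathrm{FS}(n_i;N_t)=\{n_\alpha+N_t : t\in\mathbb{N},\ \alpha\subset\{1,\dots,t\}\}$, where $n_\alpha=\sum_{i\in\alpha}n_i$. Any set containing $\mathrm{FS}(n_i;N_t)$ for some $(n_i),(N_t)$ is called an IPS-set. *)

theory Defs
  imports Complex_Main "HOL-Library.Liminf_Limsup" "HOL-Library.Extended_Real"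
    "HOL-Library.Indicator_Function"
begin

definition upper_banach_density :: "nat set \<Rightarrow> ereal" where
  "upper_banach_density E =
     limsup (\<lambda>N. ereal (real (Max (range (\<lambda>M. card (E \<inter> {M..<M+N})))) / real N))"

text \<open>\<^const>\<open>Max\<close> is unspecified on infinite sets; here the set of values is finite.\<close>

lemma finite_range_window_card: "finite (range (\<lambda>M::nat. card (E \<inter> {M..<M+N})))"
proof (rule finite_subset)
  show "range (\<lambda>M. card (E \<inter> {M..<M+N})) \<subseteq> {..N}"
  proof
    fix x assume "x \<in> range (\<lambda>M. card (E \<inter> {M..<M+N}))"
    then obtain M where x: "x = card (E \<inter> {M..<M+N})" by blast
    have "card (E \<inter> {M..<M+N}) \<le> card {M..<M+N}" by (intro card_mono) auto
    then show "x \<in> {..N}" by (simp add: x)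
  qed
qed simp

definition sparse :: "(nat \<Rightarrow> nat) \<Rightarrow> bool" where
  "sparse f \<longleftrightarrow> (\<exists>E. f = indicator E \<and> upper_banach_density E = 0)"

text \<open>Words are lists of digits, most significant digit first.\<close>

definition words :: "nat \<Rightarrow> nat list set" where
  "words k = {w. set w \<subseteq> {..<k}}"

text \<open>\<^const>\<open>horner_sum\<close> takes the least significant digit first, hence the reversal.\<close>

definition word_val :: "nat \<Rightarrow> nat list \<Rightarrow> nat" where
  "word_val k w = horner_sum id k (rev w)"

text \<open>The base-\<open>k\<close> representation without leading zeros; the representation of 0 is empty.
  The test \<open>k \<ge> 2\<close> only ensures termination.\<close>

function base_rep :: "nat \<Rightarrow> nat \<Rightarrow> nat list" where
  "base_rep k n = (if k \<ge> 2 \<and> n > 0 then base_rep k (n div k) @ [n mod k] else [])"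
  by pat_completeness auto
termination
  by (relation "measure snd") auto

declare base_rep.simps [simp del]

lemma word_val_snoc: "word_val k (w @ [d]) = k * word_val k w + d"
  by (simp add: word_val_def)

lemma base_rep_in_words:
  assumes "k \<ge> 2" shows "base_rep k n \<in> words k"
  using assms
proof (induction k n rule: base_rep.induct)
  case (1 k n)
  then show ?case by (subst base_rep.simps) (auto simp: words_def)
qed

lemma word_val_base_rep:
  assumes "k \<ge> 2" shows "word_val k (base_rep k n) = n"
  using assms
proof (induction k n rule: base_rep.induct)
  case (1 k n)
  show ?case
  proof (cases "n = 0")
    case True
    then show ?thesis by (subst base_rep.simps) (simp add: word_val_def)
  next
    case False
    then show ?thesis using 1 by (subst base_rep.simps) (simp add: word_val_snoc)
  qed
qed

lemma hd_base_rep: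
  assumes "k \<ge> 2" "n > 0" shows "base_rep k n \<noteq> [] \<and> hd (base_rep k n) \<noteq> 0"
  using assms
proof (induction k n rule: base_rep.induct)
  case (1 k n)
  show ?case
  proof (cases "n div k = 0")
    case True
    then have "n < k" using 1 by (auto simp: div_eq_0_iff)
    moreover from True have "base_rep k (n div k) = []" by (subst base_rep.simps) simp
    ultimately show ?thesis using 1 by (subst (1 2) base_rep.simps) simp
  next
    case False
    then show ?thesis using 1 by (subst (1 2) base_rep.simps) simp
  qed
qed

record ('s, 'o) automaton =
  states :: "'s set"
  init :: 's
  step :: "'s \<Rightarrow> nat \<Rightarrow> 's"
  out_set :: "'o set"
  out :: "'s \<Rightarrow> 'o"

definition is_automaton :: "nat \<Rightarrow> ('s, 'o) automaton \<Rightarrow> bool" where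
  "is_automaton k A \<longleftrightarrow>
     finite (states A) \<and> init A \<in> states A \<and>
     (\<forall>s\<in>states A. \<forall>d<k. step A s d \<in> states A) \<and>
     finite (out_set A) \<and> (\<forall>s\<in>states A. out A s \<in> out_set A)"

definition run :: "('s, 'o) automaton \<Rightarrow> 's \<Rightarrow> nat list \<Rightarrow> 's" where
  "run A s w = foldl (step A) s w"

definition generates :: "nat \<Rightarrow> ('s, 'o) automaton \<Rightarrow> (nat \<Rightarrow> 'o) \<Rightarrow> bool" where
  "generates k A a \<longleftrightarrow> is_automaton k A \<and> (\<forall>n. a n = out A (run A (init A) (base_rep k n)))"

text \<open>HOL cannot quantify over the type of states inside a definition, so the states are taken to
  be natural numbers. By \<open>generates_automatic\<close> below this is no restriction.\<close>

definition automatic :: "nat \<Rightarrow> (nat \<Rightarrow> 'o) \<Rightarrow> bool" where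
  "automatic k a \<longleftrightarrow> (\<exists>A :: (nat, 'o) automaton. generates k A a)"

lemma run_in_states:
  assumes "is_automaton k A" "s \<in> states A" "w \<in> words k"
  shows "run A s w \<in> states A"
  using assms(2,3)
proof (induction w arbitrary: s)
  case (Cons d w)
  then show ?case using assms(1) by (auto simp: run_def words_def is_automaton_def)
qed (simp add: run_def)

lemma generates_automatic:
  fixes A :: "('s, 'o) automaton"
  assumes "k \<ge> 2" "generates k A a"
  shows "automatic k a"
proof -
  have A: "is_automaton k A" and a: "\<And>n. a n = out A (run A (init A) (base_rep k n))"
    using assms(2) by (auto simp: generates_def)
  obtain h :: "'s \<Rightarrow> nat" where h: "inj_on h (states A)"
    using A finite_imp_inj_to_nat_seg unfolding is_automaton_def by metis
  define g where "g = inv_into (states A) h"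
  have g: "g (h s) = s" if "s \<in> states A" for s
    using that h by (simp add: g_def)
  define B where "B = \<lparr>states = h ` states A, init = h (init A),
    step = (\<lambda>s d. h (step A (g s) d)), out_set = out_set A, out = (\<lambda>s. out A (g s))\<rparr>"
  have B: "is_automaton k B"
    using A by (auto simp: is_automaton_def B_def g)
  have run: "run B (h s) w = h (run A s w)" if "s \<in> states A" "w \<in> words k" for s w
    using that
  proof (induction w arbitrary: s)
    case (Cons d w)
    then have "step A s d \<in> states A" "w \<in> words k"
      using A by (auto simp: words_def is_automaton_def)
    from Cons.IH[OF this] show ?case
      using Cons.prems by (simp add: run_def B_def g)
  qed (simp add: run_def)
  have "a n = out B (run B (init B) (base_rep k n))" for n
  proof -
    have i: "init A \<in> states A" using A by (simp add: is_automaton_def)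
    have w: "base_rep k n \<in> words k" by (rule base_rep_in_words) fact
    have "run B (init B) (base_rep k n) = h (run A (init A) (base_rep k n))"
      using run[OF i w] by (simp add: B_def)
    then show ?thesis
      using g[OF run_in_states[OF A i w]] a by (simp add: B_def)
  qed
  then show ?thesis
    using B unfolding automatic_def generates_def by blast
qed

definition word_pow :: "nat list \<Rightarrow> nat \<Rightarrow> nat list" where
  "word_pow u l = concat (replicate l u)"

text \<open>The word \<open>w\<^sub>0 u\<^sub>1\<^bsup>l\<^sub>1\<^esup> w\<^sub>1 \<dots> u\<^sub>r\<^bsup>l\<^sub>r\<^esup> w\<^sub>r\<close>.\<close>

definition pattern_word ::
  "nat \<Rightarrow> (nat \<Rightarrow> nat list) \<Rightarrow> (nat \<Rightarrow> nat list) \<Rightarrow> (nat \<Rightarrow> nat) \<Rightarrow> nat list" where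
  "pattern_word r w u l = w 0 @ concat (map (\<lambda>i. word_pow (u i) (l i) @ w i) [1..<Suc r])"

definition basic_very_sparse_set :: "nat \<Rightarrow> nat \<Rightarrow> nat set \<Rightarrow> bool" where
  "basic_very_sparse_set k r A \<longleftrightarrow>
     (\<exists>w u. (\<forall>i\<in>{0..r}. w i \<in> words k) \<and> (\<forall>i\<in>{1..r}. u i \<in> words k) \<and>
        A = {word_val k (pattern_word r w u l) | l. True})"

text \<open>A rank \<open>r\<close> set is also a rank \<open>r + 1\<close> set (take the additional words to be
  empty), so it makes no difference that the ranks of the pieces may vary.\<close>

definition very_sparse_set :: "nat \<Rightarrow> nat set \<Rightarrow> bool" where
  "very_sparse_set k A \<longleftrightarrow>
     (\<exists>F. finite F \<and> (\<forall>B\<in>F. \<exists>r. basic_very_sparse_set k r B) \<and> A = \<Union>F)"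

definition very_sparse :: "nat \<Rightarrow> (nat \<Rightarrow> nat) \<Rightarrow> bool" where
  "very_sparse k f \<longleftrightarrow> very_sparse_set k {n. f n = 1}"

text \<open>The sequences \<open>n\<close> and \<open>N\<close> are indexed from 1; their values at 0 are irrelevant.\<close>

definition FS :: "(nat \<Rightarrow> nat) \<Rightarrow> (nat \<Rightarrow> nat) \<Rightarrow> nat set" where
  "FS n N = {(\<Sum>i\<in>\<alpha>. n i) + N t | t \<alpha>. t \<ge> 1 \<and> \<alpha> \<subseteq> {1..t}}"

definition IPS_set :: "nat set \<Rightarrow> bool" where
  "IPS_set E \<longleftrightarrow> (\<exists>n N. (\<forall>i\<ge>1. n i \<ge> 1) \<and> FS n N \<subseteq> E)"

end

theory Submission
  imports Defs
begin

text \<open>Let \<open>s\<close> be a state that is reached by a word with nonzero first digit and from which the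
  output 1 can be reached. If two different words \<open>u\<close>, \<open>v\<close> of the same length lead from \<open>s\<close> back
  to \<open>s\<close>, then substituting \<open>u\<close> or \<open>v\<close> independently in a chain of \<open>t\<close> loops at \<open>s\<close> changes the value
  of the word by subset sums of \<open>(word_val k v - word_val k u) * k ^ (c + i * length u)\<close>, which
  yields an IPS-set. Otherwise the loops at each such state commute; since a
  deterministic automaton that returns to \<open>s\<close> after \<open>u\<close> and after \<open>u @ v\<close> also returns after reading
  \<open>v\<close> alone, they are the powers of a single word, and cutting each accepted word at its last
  visit to a state, one state after the other, writes the language as a finite union of patterns.\<close>

section \<open>Words and their values\<close>

lemma words_Nil [simp]: "[] \<in> words k"
  and words_Cons [simp]: "d # w \<in> words k \<longleftrightarrow> d < k \<and> w \<in> words k"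
  and words_append [simp]: "v @ w \<in> words k \<longleftrightarrow> v \<in> words k \<and> w \<in> words k"
  by (auto simp: words_def)

lemma word_val_append:
  "word_val k (v @ w) = word_val k v * k ^ length w + word_val k w"
proof (induction w rule: rev_induct)
  case (snoc d w)
  have "word_val k (v @ w @ [d]) = k * word_val k (v @ w) + d"
    using word_val_snoc[of k "v @ w"] by simp
  then show ?case by (simp add: snoc word_val_snoc algebra_simps)
qed (simp add: word_val_def)

lemma word_val_Cons: "word_val k (d # w) = d * k ^ length w + word_val k w"
proof -
  have "word_val k ([d] @ w) = word_val k [d] * k ^ length w + word_val k w"
    by (rule word_val_append)
  then show ?thesis by (simp add: word_val_def)
qed

lemma word_val_Cons_pos:
  assumes "k \<ge> 2" "d > 0"
  shows "word_val k (d # w) > 0"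
  using assms by (simp add: word_val_Cons)

text \<open>The nonzero leading digit keeps the value of every nonempty prefix positive, so
  \<open>base_rep\<close> never stops early. Digits are appended in the induction because
  \<open>base_rep\<close> splits off the last one.\<close>

lemma base_rep_word_val:
  assumes "k \<ge> 2" "d > 0" "d < k" "w \<in> words k"
  shows "base_rep k (word_val k (d # w)) = d # w"
  using assms(4)
proof (induction w rule: rev_induct)
  case Nil
  then show ?case using assms(1-3)
    by (simp add: word_val_def base_rep.simps[of k d] base_rep.simps[of k 0])
next
  case (snoc e w)
  then have e: "e < k" "w \<in> words k" by auto
  have v: "word_val k (d # w @ [e]) = k * word_val k (d # w) + e"
    using word_val_snoc[of k "d # w" e] by simp
  have "word_val k (d # w @ [e]) > 0" using word_val_Cons_pos[OF assms(1,2)] .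
  then show ?case
    using assms(1) e snoc.IH by (subst base_rep.simps) (simp add: v)
qed

lemma word_val_inj:
  assumes "k \<ge> 2" "v \<in> words k" "w \<in> words k" "length v = length w"
    and "word_val k v = word_val k w"
  shows "v = w"
proof -
  \<comment> \<open>Prefixing the digit 1 rules out leading zeros, so that \<open>base_rep\<close>
    recovers both words from their common value.\<close>
  have "word_val k (1 # v) = word_val k (1 # w)"
    using assms(4,5) by (simp add: word_val_Cons)
  then have "(1::nat) # v = 1 # w"
    using base_rep_word_val[of k 1] assms by (metis Suc_1 Suc_le_lessD zero_less_one)
  then show ?thesis by simp
qed

section \<open>Finite unions of pattern languages\<close>

text \<open>Word-level counterpart of \<open>basic_very_sparse_set\<close>: concatenation is handled
  on languages, and values are taken only at the end. The rank stays existential because it grows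
  along the proof.\<close>

definition pattern_lang :: "nat \<Rightarrow> nat list set \<Rightarrow> bool" where
  "pattern_lang k L \<longleftrightarrow> (\<exists>r w u. (\<forall>i\<in>{0..r}. w i \<in> words k) \<and> (\<forall>i\<in>{1..r}. u i \<in> words k) \<and>
     L = {pattern_word r w u l | l. True})"

definition very_sparse_lang :: "nat \<Rightarrow> nat list set \<Rightarrow> bool" where
  "very_sparse_lang k L \<longleftrightarrow> (\<exists>F. finite F \<and> (\<forall>P\<in>F. pattern_lang k P) \<and> L = \<Union>F)"

lemma very_sparse_lang_empty: "very_sparse_lang k {}"
  unfolding very_sparse_lang_def by (rule exI[of _ "{}"]) simp

lemma very_sparse_lang_Nil: "very_sparse_lang k {[]}"
proof -
  have "pattern_lang k {[]}"
    unfolding pattern_lang_def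
    by (rule exI[of _ 0], rule exI[of _ "\<lambda>_. []"], rule exI[of _ "\<lambda>_. []"])
      (simp add: pattern_word_def)
  then show ?thesis unfolding very_sparse_lang_def by (intro exI[of _ "{{[]}}"]) simp
qed

lemma very_sparse_lang_Un:
  assumes "very_sparse_lang k L" "very_sparse_lang k M"
  shows "very_sparse_lang k (L \<union> M)"
proof -
  obtain F G where "finite F" "\<forall>P\<in>F. pattern_lang k P" "L = \<Union>F"
    and "finite G" "\<forall>P\<in>G. pattern_lang k P" "M = \<Union>G"
    using assms unfolding very_sparse_lang_def by blast
  then show ?thesis
    unfolding very_sparse_lang_def by (intro exI[of _ "F \<union> G"]) auto
qed

lemma very_sparse_lang_UN:
  assumes "finite I" "\<And>i. i \<in> I \<Longrightarrow> very_sparse_lang k (L i)"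
  shows "very_sparse_lang k (\<Union>i\<in>I. L i)"
  using assms
  by (induction I rule: finite_induct) (auto intro: very_sparse_lang_empty very_sparse_lang_Un)

text \<open>Reduces a closure property of finite unions to single patterns. As \<open>h\<close>
  returns a set of words, it covers both prefixing one digit and prefixing all powers of a
  word.\<close>

lemma very_sparse_lang_Union_image:
  assumes "very_sparse_lang k L"
    and "\<And>P. pattern_lang k P \<Longrightarrow> pattern_lang k (\<Union>x\<in>P. h x)"
  shows "very_sparse_lang k (\<Union>x\<in>L. h x)"
proof -
  obtain F where F: "finite F" "\<forall>P\<in>F. pattern_lang k P" "L = \<Union>F"
    using assms(1) unfolding very_sparse_lang_def by blast
  show ?thesis
    unfolding very_sparse_lang_def
    by (rule exI[of _ "(\<lambda>P. \<Union>x\<in>P. h x) ` F"]) (use F assms(2) in auto)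
qed

lemma very_sparse_lang_Cons:
  assumes "very_sparse_lang k L" "d < k"
  shows "very_sparse_lang k ((#) d ` L)"
proof -
  have "pattern_lang k (\<Union>x\<in>P. {d # x})" if pat: "pattern_lang k P" for P
  proof -
    obtain r w u where wu: "\<forall>i\<in>{0..r}. w i \<in> words k" "\<forall>i\<in>{1..r}. u i \<in> words k"
      and P: "P = {pattern_word r w u l | l. True}"
      using pat unfolding pattern_lang_def by blast
    \<comment> \<open>The new digit is absorbed into the first fixed word, so the rank stays the
      same.\<close>
    have *: "d # pattern_word r w u l = pattern_word r (w(0 := d # w 0)) u l" for l
    proof -
      have "map (\<lambda>i. word_pow (u i) (l i) @ (w(0 := d # w 0)) i) [1..<Suc r]
          = map (\<lambda>i. word_pow (u i) (l i) @ w i) [1..<Suc r]"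
        by (intro map_cong) auto
      then show ?thesis by (simp only: pattern_word_def fun_upd_same append_Cons)
    qed
    have "(\<Union>x\<in>P. {d # x}) = {pattern_word r (w(0 := d # w 0)) u l | l. True}"
      unfolding P using * by auto
    then show ?thesis
      unfolding pattern_lang_def using wu assms(2)
      by (intro exI[of _ r] exI[of _ "w(0 := d # w 0)"] exI[of _ u]) auto
  qed
  from very_sparse_lang_Union_image[OF assms(1) this] show ?thesis
    by (simp add: UNION_singleton_eq_range)
qed

text \<open>The index shift makes room for a new block at index 1; the old initial word
  \<open>w 0\<close> becomes the fixed word after this block.\<close>

lemma pattern_word_Suc:
  assumes "\<And>i. i \<ge> 1 \<Longrightarrow> w' (Suc i) = w i" "\<And>i. i \<ge> 1 \<Longrightarrow> u' (Suc i) = u i"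
    and "w' 1 = w 0"
  shows "pattern_word (Suc r) w' u' l
    = w' 0 @ word_pow (u' 1) (l 1) @ pattern_word r w u (\<lambda>i. l (Suc i))"
proof -
  have "[1..<Suc (Suc r)] = 1 # map Suc [1..<Suc r]"
    by (simp add: upt_conv_Cons map_Suc_upt del: upt_Suc)
  moreover have "map (\<lambda>i. word_pow (u' i) (l i) @ w' i) (map Suc [1..<Suc r])
      = map (\<lambda>i. word_pow (u i) (l (Suc i)) @ w i) [1..<Suc r]"
    using assms(1,2) by auto
  ultimately show ?thesis by (simp add: pattern_word_def assms(3)[simplified] del: upt_Suc map_map)
qed

lemma very_sparse_lang_powers_append:
  assumes "very_sparse_lang k L" "v \<in> words k"
  shows "very_sparse_lang k {word_pow v n @ x | n x. x \<in> L}"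
proof -
  have "pattern_lang k (\<Union>x\<in>P. {word_pow v n @ x | n. True})" if pat: "pattern_lang k P" for P
  proof -
    obtain r w u where wu: "\<forall>i\<in>{0..r}. w i \<in> words k" "\<forall>i\<in>{1..r}. u i \<in> words k"
      and P: "P = {pattern_word r w u l | l. True}"
      using pat unfolding pattern_lang_def by blast
    \<comment> \<open>The rank grows by one: an empty fixed word, then powers of \<open>v\<close>,
      then the old data shifted by one.\<close>
    define w' where "w' = case_nat [] w"
    define u' where "u' i = (if i = 1 then v else u (i - 1))" for i
    have *: "pattern_word (Suc r) w' u' l
        = word_pow v (l 1) @ pattern_word r w u (\<lambda>i. l (Suc i))" for l
      using pattern_word_Suc[of w' w u' u r l] by (simp add: w'_def u'_def)
    have "word_pow v n @ pattern_word r w u l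
        = pattern_word (Suc r) w' u' (\<lambda>i. if i = 1 then n else l (i - 1))" for n l
    proof -
      have "pattern_word r w u (\<lambda>i. if Suc i = 1 then n else l (Suc i - 1))
          = pattern_word r w u l"
        unfolding pattern_word_def by (intro arg_cong2[of _ _ _ _ "(@)"] arg_cong[of _ _ concat]) auto
      then show ?thesis unfolding * by simp
    qed
    then have "(\<Union>x\<in>P. {word_pow v n @ x | n. True}) = {pattern_word (Suc r) w' u' l | l. True}"
      unfolding P using * by blast
    moreover have "\<forall>i\<in>{0..Suc r}. w' i \<in> words k"
      using wu(1) by (auto simp: w'_def split: nat.splits)
    moreover have "\<forall>i\<in>{1..Suc r}. u' i \<in> words k"
    proof
      fix i assume "i \<in> {1..Suc r}"
      then have "i = 1 \<or> i - 1 \<in> {1..r}" by auto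
      then show "u' i \<in> words k" using wu(2) assms(2) by (auto simp: u'_def)
    qed
    ultimately show ?thesis
      unfolding pattern_lang_def by blast
  qed
  from very_sparse_lang_Union_image[OF assms(1) this]
  have "very_sparse_lang k (\<Union>x\<in>L. {word_pow v n @ x | n. True})" .
  moreover have "(\<Union>x\<in>L. {word_pow v n @ x | n. True}) = {word_pow v n @ x | n x. x \<in> L}"
    by blast
  ultimately show ?thesis by simp
qed

lemma very_sparse_set_word_val:
  assumes "very_sparse_lang k L"
  shows "very_sparse_set k (word_val k ` L)"
proof -
  obtain F where F: "finite F" "\<forall>P\<in>F. pattern_lang k P" "L = \<Union>F"
    using assms unfolding very_sparse_lang_def by blast
  have "\<exists>r. basic_very_sparse_set k r (word_val k ` P)" if P: "pattern_lang k P" for P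
  proof -
    obtain r w u where wu: "\<forall>i\<in>{0..r}. w i \<in> words k" "\<forall>i\<in>{1..r}. u i \<in> words k"
      and "P = {pattern_word r w u l | l. True}"
      using P unfolding pattern_lang_def by blast
    then have "word_val k ` P = {word_val k (pattern_word r w u l) | l. True}" by auto
    with wu show ?thesis unfolding basic_very_sparse_set_def by blast
  qed
  with F show ?thesis
    unfolding very_sparse_set_def by (intro exI[of _ "(`) (word_val k) ` F"]) auto
qed

section \<open>Loops of an automaton\<close>

lemma run_Nil [simp]: "run A s [] = s"
  and run_Cons [simp]: "run A s (d # w) = run A (step A s d) w"
  and run_append [simp]: "run A s (v @ w) = run A (run A s v) w"
  by (simp_all add: run_def)

section \<open>Runs that avoid a set of states\<close>

fun avoids :: "('s, 'o) automaton \<Rightarrow> 's set \<Rightarrow> 's \<Rightarrow> nat list \<Rightarrow> bool" where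
  "avoids A X s [] \<longleftrightarrow> s \<notin> X"
| "avoids A X s (d # w) \<longleftrightarrow> s \<notin> X \<and> avoids A X (step A s d) w"

lemma avoids_append:
  "avoids A X s (v @ w) \<longleftrightarrow> avoids A X s v \<and> avoids A X (run A s v) w"
proof (induction v arbitrary: s)
  case Nil
  \<comment> \<open>The state where the two words meet is tested on both sides, and the test for
    \<open>w\<close> already includes its starting state.\<close>
  then show ?case by (cases w) auto
qed auto

lemma avoids_mono: "avoids A Y s w \<Longrightarrow> X \<subseteq> Y \<Longrightarrow> avoids A X s w"
  by (induction w arbitrary: s) auto

lemma avoids_empty [simp]: "avoids A {} s w"
  by (induction w arbitrary: s) auto

text \<open>Since \<open>avoids\<close> also tests the starting state, no run from \<open>q\<close>
  avoids \<open>q\<close>. Hence the letter \<open>d\<close> read after the last visit is split off,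
  and a word that ends in \<open>q\<close> forms a case of its own.\<close>

lemma avoids_last_visit:
  assumes "avoids A X s w"
  obtains (avoid) "avoids A (insert q X) s w"
  | (visit) v where "w = v" "run A s v = q" "avoids A X s v"
  | (leave) v d w' where "w = v @ d # w'" "run A s v = q" "avoids A X s v"
      "avoids A (insert q X) (step A q d) w'"
  using assms
proof (induction w arbitrary: s thesis)
  case Nil
  then show ?case by (cases "s = q") auto
next
  case (Cons e w)
  have X: "s \<notin> X" "avoids A X (step A s e) w" using Cons.prems(4) by auto
  show ?case
  proof (rule Cons.IH[OF _ _ _ X(2)])
    assume *: "avoids A (insert q X) (step A s e) w"
    \<comment> \<open>Without a later visit to \<open>q\<close>, either \<open>s\<close> itself is
      the last visit, with empty \<open>v\<close>, or there is none.\<close>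
    show ?case
    proof (cases "s = q")
      case True
      then show ?thesis using Cons.prems(3)[of "[]" e w] * X by simp
    next
      case False
      then show ?thesis using Cons.prems(1) * X by simp
    qed
  next
    fix v assume "w = v" "run A (step A s e) v = q" "avoids A X (step A s e) v"
    then show ?case using Cons.prems(2)[of "e # v"] X by simp
  next
    fix v d w'
    assume "w = v @ d # w'" "run A (step A s e) v = q" "avoids A X (step A s e) v"
      "avoids A (insert q X) (step A q d) w'"
    then show ?case using Cons.prems(3)[of "e # v" d w'] X by simp
  qed
qed

section \<open>Submonoids generated by one word\<close>

lemma word_pow_0 [simp]: "word_pow u 0 = []"
  and word_pow_Suc [simp]: "word_pow u (Suc n) = u @ word_pow u n"
  by (simp_all add: word_pow_def)

text \<open>The generator \<open>u\<close> is a shortest nonempty element. For nonempty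
  \<open>x\<close> in \<open>M\<close> the words \<open>u @ x\<close> and \<open>x @ u\<close> have
  equal length, hence coincide, so \<open>u\<close> is a prefix of \<open>x\<close>; by unitarity
  the shorter rest lies in \<open>M\<close> again.\<close>

lemma unitary_submonoid_cyclic:
  assumes Nil: "[] \<in> M"
    and append: "\<And>x y. x \<in> M \<Longrightarrow> y \<in> M \<Longrightarrow> x @ y \<in> M"
    and unitary: "\<And>x y. x \<in> M \<Longrightarrow> x @ y \<in> M \<Longrightarrow> y \<in> M"
    and unique: "\<And>x y. x \<in> M \<Longrightarrow> y \<in> M \<Longrightarrow> length x = length y \<Longrightarrow> x = y"
  obtains u where "u \<in> M" "M = range (word_pow u)"
proof (cases "M = {[]}")
  case True
  have "word_pow [] n = []" for n by (simp add: word_pow_def)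
  with True that[of "[]"] show ?thesis by auto
next
  case False
  then obtain y where "y \<in> M \<and> y \<noteq> []" using Nil by blast
  from ex_has_least_nat[of "\<lambda>y. y \<in> M \<and> y \<noteq> []", OF this, of length]
  obtain u where u: "u \<in> M" "u \<noteq> []"
    and least: "\<And>y. y \<in> M \<Longrightarrow> y \<noteq> [] \<Longrightarrow> length u \<le> length y" by blast
  have "x \<in> range (word_pow u)" if "x \<in> M" for x
    using that
  proof (induction x rule: length_induct)
    case (1 x)
    show ?case
    proof (cases "x = []")
      case True
      then show ?thesis using word_pow_0[of u] by (metis rangeI)
    next
      case False
      have "u @ x = x @ u" by (rule unique) (use append u 1 in auto)
      moreover have "length u \<le> length x" using least 1 False by blast
      ultimately obtain y where y: "x = u @ y"
        by (metis append_eq_append_conv_if append_eq_conv_conj append_take_drop_id)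
      then have "y \<in> M" using unitary u 1 by blast
      then have "y \<in> range (word_pow u)" using 1(1) u(2) y by simp
      then obtain n where "y = word_pow u n" by blast
      then have "x = word_pow u (Suc n)" by (simp add: y)
      then show ?thesis by blast
    qed
  qed
  moreover have "word_pow u n \<in> M" for n
    by (induction n) (use Nil append u in auto)
  ultimately show ?thesis using that u by blast
qed

section \<open>Decomposition of languages at last visits\<close>

definition avoiding_lang ::
  "nat \<Rightarrow> ('s, 'o) automaton \<Rightarrow> 's set \<Rightarrow> 's set \<Rightarrow> 's \<Rightarrow> nat list set" where
  "avoiding_lang k A T X s = {w \<in> words k. avoids A X s w \<and> run A s w \<in> T}"

text \<open>Each word is cut at its last visit to \<open>s\<close>: what precedes is a loop, and
  what follows is empty or a letter and then a run that never sees \<open>s\<close> again.\<close>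

lemma avoiding_lang_rec:
  assumes "s \<notin> X"
  shows "avoiding_lang k A T X s = {v @ w | v w.
    v \<in> {v \<in> words k. avoids A X s v \<and> run A s v = s} \<and>
    w \<in> (if s \<in> T then {[]} else {})
      \<union> (\<Union>d<k. (#) d ` avoiding_lang k A T (insert s X) (step A s d))}" (is "_ = ?R")
proof (intro equalityI subsetI)
  fix w assume "w \<in> avoiding_lang k A T X s"
  then have w: "w \<in> words k" "avoids A X s w" "run A s w \<in> T"
    by (auto simp: avoiding_lang_def)
  from w(2) show "w \<in> ?R"
  proof (cases rule: avoids_last_visit[where q = s])
    case avoid
    \<comment> \<open>This case cannot occur, as the run starts in \<open>s\<close>.\<close>
    then show ?thesis by (cases w) auto
  next
    case (visit v)
    then show ?thesis using w by (intro CollectI exI[of _ v] exI[of _ "[]"]) auto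
  next
    case (leave v d w')
    then show ?thesis using w
      by (intro CollectI exI[of _ v] exI[of _ "d # w'"]) (auto simp: avoiding_lang_def)
  qed
next
  fix w assume "w \<in> ?R"
  then show "w \<in> avoiding_lang k A T X s"
    using assms
    by (auto simp: avoiding_lang_def avoids_append split: if_splits
        intro: avoids_mono[of A "insert s X"])
qed

text \<open>Induction on the number of states of \<open>S\<close> outside \<open>X\<close>: after
  its last visit \<open>s\<close> joins the avoided set. The word \<open>z\<close> in
  \<open>unique\<close> confines uniqueness to loops at states from which \<open>T\<close> can be
  reached; elsewhere the language is empty.\<close>

lemma very_sparse_avoiding_lang:
  assumes "finite S"
    and closed: "\<And>s d. s \<in> S \<Longrightarrow> d < k \<Longrightarrow> step A s d \<in> S"
    and unique: "\<And>s x y z. s \<in> S \<Longrightarrow> x \<in> words k \<Longrightarrow> y \<in> words k \<Longrightarrow> z \<in> words k \<Longrightarrow>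
      run A s x = s \<Longrightarrow> run A s y = s \<Longrightarrow> run A s z \<in> T \<Longrightarrow> length x = length y \<Longrightarrow> x = y"
    and "s \<in> S"
  shows "very_sparse_lang k (avoiding_lang k A T X s)"
  using \<open>s \<in> S\<close>
proof (induction "card (S - X)" arbitrary: X s rule: less_induct)
  case less
  show ?case
  proof (cases "avoiding_lang k A T X s = {}")
    case True
    then show ?thesis by (simp add: very_sparse_lang_empty)
  next
    case False
    \<comment> \<open>The word \<open>z\<close> serves twice: its start gives
      \<open>s \<notin> X\<close>, and its end supplies the path into \<open>T\<close> that
      \<open>unique\<close> asks for.\<close>
    then obtain z where z: "z \<in> words k" "avoids A X s z" "run A s z \<in> T"
      by (auto simp: avoiding_lang_def)
    then have s: "s \<notin> X" by (cases z) auto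
    define M where "M = {v \<in> words k. avoids A X s v \<and> run A s v = s}"
    obtain u where u: "u \<in> M" "M = range (word_pow u)"
    proof (rule unitary_submonoid_cyclic[of M])
      show "[] \<in> M" using s by (simp add: M_def)
      show "x @ y \<in> M" if "x \<in> M" "y \<in> M" for x y
        using that by (simp add: M_def avoids_append)
      show "y \<in> M" if "x \<in> M" "x @ y \<in> M" for x y
        using that by (auto simp: M_def avoids_append)
      show "x = y" if "x \<in> M" "y \<in> M" "length x = length y" for x y
        using that unique[OF less.prems _ _ z(1) _ _ z(3)] by (auto simp: M_def)
    qed blast
    define E where "E = (if s \<in> T then {[]} else {})
      \<union> (\<Union>d<k. (#) d ` avoiding_lang k A T (insert s X) (step A s d))"
    have "card (S - insert s X) < card (S - X)"
      using assms(1) less.prems s by (intro psubset_card_mono) auto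
    then have "very_sparse_lang k (avoiding_lang k A T (insert s X) (step A s d))" if "d < k" for d
      using less.hyps closed[OF less.prems that] by blast
    then have "very_sparse_lang k E"
      unfolding E_def
      by (intro very_sparse_lang_Un very_sparse_lang_UN very_sparse_lang_Cons)
        (auto simp: very_sparse_lang_empty very_sparse_lang_Nil)
    moreover have "avoiding_lang k A T X s = {word_pow u n @ x | n x. x \<in> E}"
      unfolding avoiding_lang_rec[OF s] M_def[symmetric] E_def[symmetric] u(2) by blast
    ultimately show ?thesis
      using very_sparse_lang_powers_append[of k E u] u(1) by (simp add: M_def)
  qed
qed

section \<open>Independent loops and IPS-sets\<close>

text \<open>Loops are laid down in the order \<open>t\<close>, ..., 1, so that loop \<open>i\<close>
  is followed by exactly \<open>i - 1\<close> loops and \<open>z\<close>. For \<open>u\<close> and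
  \<open>v\<close> of equal length its place value then does not depend on \<open>t\<close>.\<close>

fun loop_choice :: "nat list \<Rightarrow> nat list \<Rightarrow> nat list \<Rightarrow> nat set \<Rightarrow> nat \<Rightarrow> nat list" where
  "loop_choice u v z \<alpha> 0 = z"
| "loop_choice u v z \<alpha> (Suc t) = (if Suc t \<in> \<alpha> then v else u) @ loop_choice u v z \<alpha> t"

lemma loop_choice_words:
  "u \<in> words k \<Longrightarrow> v \<in> words k \<Longrightarrow> z \<in> words k \<Longrightarrow> loop_choice u v z \<alpha> t \<in> words k"
  by (induction t) auto

lemma run_loop_choice:
  "run A s u = s \<Longrightarrow> run A s v = s \<Longrightarrow> run A s (loop_choice u v z \<alpha> t) = run A s z"
  by (induction t) auto

lemma length_loop_choice:
  "length u = length v \<Longrightarrow> length (loop_choice u v z \<alpha> t) = length z + t * length v"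
  by (induction t) auto

text \<open>Words of equal length can be exchanged without moving the other digits, so the exchanges
  contribute independently. The order hypothesis makes the truncated subtraction exact.\<close>

lemma word_val_loop_choice:
  assumes "length u = length v" "word_val k u \<le> word_val k v"
  shows "word_val k (loop_choice u v z \<alpha> t) = word_val k (loop_choice u v z {} t)
    + (\<Sum>i\<in>\<alpha> \<inter> {1..t}. (word_val k v - word_val k u) * k ^ (length z + (i - 1) * length v))"
proof (induction t)
  case (Suc t)
  have "\<alpha> \<inter> {1..Suc t} = (if Suc t \<in> \<alpha> then insert (Suc t) (\<alpha> \<inter> {1..t}) else \<alpha> \<inter> {1..t})"
    by (auto simp: le_Suc_eq)
  moreover obtain e where "word_val k v = word_val k u + e"
    using assms(2) le_Suc_ex by blast
  ultimately show ?case
    using assms(1)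
    by (simp add: Suc.IH word_val_append length_loop_choice add_mult_distrib)
qed simp

lemma IPS_set_loops:
  assumes k: "k \<ge> 2" and d: "0 < d" "d < k"
    and words: "p \<in> words k" "u \<in> words k" "v \<in> words k" "z \<in> words k"
    and run: "run A s0 (d # p) = s" "run A s u = s" "run A s v = s" "run A s z \<in> T"
    and uv: "length u = length v" "word_val k u < word_val k v"
  shows "IPS_set {n. run A s0 (base_rep k n) \<in> T}"
proof -
  define n where
    "n i = (word_val k v - word_val k u) * k ^ (length z + (i - 1) * length v)" for i
  \<comment> \<open>The shift belongs to the empty subset, that is, to \<open>u\<close> in all
    \<open>t\<close> loops.\<close>
  define N where "N t = word_val k (d # p @ loop_choice u v z {} t)" for t
  have "FS n N \<subseteq> {n. run A s0 (base_rep k n) \<in> T}"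
  proof
    fix m assume "m \<in> FS n N"
    then obtain t \<alpha> where \<alpha>: "\<alpha> \<subseteq> {1..t}" and m: "m = sum n \<alpha> + N t"
      by (auto simp: FS_def)
    have "\<alpha> \<inter> {1..t} = \<alpha>" using \<alpha> by blast
    then have "word_val k (loop_choice u v z \<alpha> t) = word_val k (loop_choice u v z {} t) + sum n \<alpha>"
      using word_val_loop_choice[of u v k z \<alpha> t] uv by (simp add: n_def)
    then have "m = word_val k (d # p @ loop_choice u v z \<alpha> t)"
      unfolding m N_def
      using word_val_append[of k "d # p"] by (simp add: length_loop_choice uv)
    \<comment> \<open>As \<open>d\<close> is nonzero, this word is the one that the automaton reads
      on input \<open>m\<close>.\<close>
    then have "base_rep k m = d # p @ loop_choice u v z \<alpha> t"
      using base_rep_word_val[OF k d] words by (simp add: loop_choice_words)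
    then show "m \<in> {n. run A s0 (base_rep k n) \<in> T}"
      using run by (simp add: run_loop_choice)
  qed
  \<comment> \<open>The strict inequality between the values of \<open>u\<close> and
    \<open>v\<close> makes the generators positive.\<close>
  moreover have "n i \<ge> 1" for i
    using uv k by (simp add: n_def Suc_le_eq)
  ultimately show ?thesis unfolding IPS_set_def by blast
qed

section \<open>Dichotomy for the loops of a generating automaton\<close>

theorem theorem3p13:
  fixes k :: nat and f :: "nat \<Rightarrow> nat"
  assumes "k \<ge> 2"
    and "\<And>n. f n \<in> {0, 1}"
    and "sparse f"
    and "automatic k f"
  shows "very_sparse k f \<or> (\<exists>E. IPS_set E \<and> (\<forall>n\<in>E. f n = 1))"
proof -
  obtain A :: "(nat, nat) automaton" where A: "is_automaton k A"
    and f: "\<And>n. f n = out A (run A (init A) (base_rep k n))"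
    using assms(4) unfolding automatic_def generates_def by blast
  define T where "T = {s. out A s = 1}"
  \<comment> \<open>A nonzero first digit makes the words read genuine representations. The initial
    state, which may have loops reading leading zeros, belongs to \<open>S\<close> only if such a
    word returns to it.\<close>
  define S where "S = {run A (init A) (d # p) | d p. 0 < d \<and> d < k \<and> p \<in> words k}"
  have fT: "f n = 1 \<longleftrightarrow> run A (init A) (base_rep k n) \<in> T" for n
    by (simp add: f T_def)
  show ?thesis
  \<comment> \<open>Over all ordered pairs of loops, the one-sided bound forces equal values; its
    negation directly yields \<open>u\<close> of smaller value than \<open>v\<close>.\<close>
  proof (cases "\<forall>s\<in>S. \<forall>u\<in>words k. \<forall>v\<in>words k. \<forall>z\<in>words k. run A s u = s \<longrightarrow> run A s v = s \<longrightarrow>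
      run A s z \<in> T \<longrightarrow> length u = length v \<longrightarrow> word_val k u \<ge> word_val k v")
    case False
    then obtain s u v z where "s \<in> S" and uvz: "u \<in> words k" "v \<in> words k" "z \<in> words k"
      "run A s u = s" "run A s v = s" "run A s z \<in> T"
      "length u = length v" "word_val k u < word_val k v"
      by (metis not_le)
    then obtain d p where dp: "0 < d" "d < k" "p \<in> words k" "run A (init A) (d # p) = s"
      unfolding S_def by blast
    have "IPS_set {n. run A (init A) (base_rep k n) \<in> T}"
      by (rule IPS_set_loops[OF assms(1) dp(1-3) uvz(1-3) dp(4) uvz(4-8)])
    then show ?thesis using fT by blast
  next
    case True
    have init: "init A \<in> states A" using A by (simp add: is_automaton_def)
    have "S \<subseteq> states A"
      unfolding S_def using run_in_states[OF A init] by (auto simp del: run_Cons)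
    then have "finite S" using A finite_subset by (auto simp: is_automaton_def)
    have closed: "step A s e \<in> S" if "s \<in> S" "e < k" for s e
    proof -
      from that(1) obtain d p where "0 < d" "d < k" "p \<in> words k" "s = run A (init A) (d # p)"
        by (auto simp: S_def)
      moreover from this have "step A s e = run A (init A) (d # p @ [e])" by simp
      ultimately show ?thesis using that(2) unfolding S_def
        by (intro CollectI exI[of _ d] exI[of _ "p @ [e]"]) simp
    qed
    have unique: "x = y"
      if "s \<in> S" "x \<in> words k" "y \<in> words k" "z \<in> words k" "run A s x = s" "run A s y = s"
        "run A s z \<in> T" "length x = length y" for s x y z
    proof -
      have "word_val k x \<ge> word_val k y" using True that by blast
      moreover have "word_val k y \<ge> word_val k x"
        using True that(1-7) that(8)[symmetric] by blast
      ultimately show ?thesis using word_val_inj[OF assms(1) that(2,3,8)] by simp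
    qed
    \<comment> \<open>The first digit is read separately because the initial state need not lie in
      \<open>S\<close>.\<close>
    define D where "D = (\<Union>d\<in>{0<..<k}. (#) d ` avoiding_lang k A T {} (step A (init A) d))"
    \<comment> \<open>The number 0 is represented by the empty word, which has no leading digit and
      is added by hand.\<close>
    define L where "L = (if f 0 = 1 then {[]} else {}) \<union> D"
    have "step A (init A) d \<in> S" if "d \<in> {0<..<k}" for d
      using that unfolding S_def by (intro CollectI exI[of _ d] exI[of _ "[]"]) simp
    then have "very_sparse_lang k L"
      unfolding L_def D_def
      by (intro very_sparse_lang_Un very_sparse_lang_UN very_sparse_lang_Cons
          very_sparse_avoiding_lang[OF \<open>finite S\<close> closed unique])
        (simp_all add: very_sparse_lang_empty very_sparse_lang_Nil)
    moreover have "{n. f n = 1} = word_val k ` L"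
    proof (intro equalityI subsetI)
      fix n assume "n \<in> {n. f n = 1}"
      then have n: "f n = 1" by simp
      have "base_rep k n \<in> L"
      proof (cases "n = 0")
        case True
        then show ?thesis using n by (simp add: L_def base_rep.simps[of k 0])
      next
        case False
        then obtain d w where dw: "base_rep k n = d # w" "d > 0"
          using hd_base_rep[OF assms(1), of n] by (cases "base_rep k n") auto
        then have "d < k" "w \<in> words k" using base_rep_in_words[OF assms(1), of n] by auto
        then show ?thesis
          using dw n[unfolded fT] by (auto simp: L_def D_def avoiding_lang_def)
      qed
      then show "n \<in> word_val k ` L"
        by (metis word_val_base_rep[OF assms(1)] imageI)
    next
      fix n assume "n \<in> word_val k ` L"
      then obtain w where w: "w \<in> L" "n = word_val k w" by blast
      consider "w = []" "f 0 = 1" | "w \<in> D" using w(1) by (auto simp: L_def split: if_splits)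
      then show "n \<in> {n. f n = 1}"
      proof cases
        case 1
        then show ?thesis using w by (simp add: word_val_def)
      next
        case 2
        then obtain d x where "w = d # x" "0 < d" "d < k" "x \<in> words k"
          "run A (init A) (d # x) \<in> T"
          by (auto simp: D_def avoiding_lang_def)
        then show ?thesis using w base_rep_word_val[OF assms(1)] by (simp add: fT[simplified])
      qed
    qed
    ultimately show ?thesis
      unfolding very_sparse_def using very_sparse_set_word_val by simp
  qed
qed

end
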